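(* Let $G$ be a braided simplicial group. Let $B_{n+1}(\mathcal Z(G)_n)=\{\sigma\in B_{n+1}\mid \sigma x\simeq x\text{ for all }x\in\mathcal Z(G)_n\}$. Then: 1) $B_{n+1}(\mathcal Z(G)_n)=\tilde B_{n+1}$ or $B_{n+1}$; 2) $B_{n+1}(\mathcal Z(G)_n)=B_{n+1}$ if and only if $2\cdot\pi_n(G)=0$.
   Context: Braided simplicial groups: a simplicial group $G=(G_n,d_j,s_j)$ is braided if for every $n$ there is an action by group automorphisms of the braid group $B_{n+1}$ on $G_n$, where the standard generators of $B_{n+1}$ are labelled $\sigma_{-1},\sigma_0,\dots,\sigma_{n-2}$, such that for all $n$, all $-1\le k\le n-2$ and $0\le j\le n$ the following hold on $G_n$ (composition right to left): $d_j\sigma_k=\sigma_{k-1}d_j$ if $j\le k$, $d_{k+1}\sigma_k=d_{k+2}$, $d_{k+2}\sigma_k=d_{k+1}$, $d_j\sigma_k=\sigma_kd_j$ if $j>k+2$; $s_j\sigma_k=\sigma_{k+1}s_j$ if $j\le k$, $s_{k+1}\sigma_k=\sigma_{k+1}\sigma_ks_{k+2}$, $s_{k+2}\sigma_k=\sigma_k\sigma_{k+1}s_{k+1}$, $s_j\sigma_k=\sigma_ks_j$ if $j>k+2$. The index $n$ denotes a simplicial dimension of $G$. Cycles: $\mathcal Z(G)_n=\{x\in G_n\mid d_jx=1\text{ for all }j\}$. Boundaries: $\mathcal B(G)_n=\{d_0x\mid x\in G_{n+1},\ d_jx=1\text{ for all }j>0\}$. $\pi_n(G)=\mathcal Z(G)_n/\mathcal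 B(G)_n$ (written additively in part 2). For $x,y\in G_n$, write $x\simeq y$ if $xy^{-1}\in\mathcal B(G)_n$. $\tilde B_{n+1}$ is the kernel of the composite $B_{n+1}\to\Sigma_{n+1}\xrightarrow{\ \mathrm{sign}\ }\mathbb Z/2$, i.e. the preimage of the alternating group $A_{n+1}$.
   Formalization: Part 2 is stated for n ≥ 1 only: for n = 0 the group B_1 is trivial, so B_1(Z(G)_0) = B_1 always, while 2·π_0(G) = 0 can fail (constant simplicial group Z/3 with trivial braid actions). Part 1 covers all n ≥ 0. *)

theory Defs
  imports "HOL-Algebra.Sym_Groups" "HOL-Algebra.Bij" "HOL-Algebra.Coset"
begin

section \<open>Groups given by generators and relations\<close>

text \<open>A word is a list of letters; \<open>(x, True)\<close> stands for the generator \<open>x\<close> and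
  \<open>(x, False)\<close> for its formal inverse. A relation \<open>u = v\<close> is the pair \<open>(u, v)\<close>.\<close>

type_synonym 'g word = "('g \<times> bool) list"

definition words :: "'g set \<Rightarrow> 'g word set"
  where "words X = lists (X \<times> UNIV)"

inductive_set pres_rel :: "'g set \<Rightarrow> ('g word \<times> 'g word) set \<Rightarrow> ('g word \<times> 'g word) set"
  for X :: "'g set" and R :: "('g word \<times> 'g word) set"
where
  relation: "\<lbrakk>(u, v) \<in> R; u \<in> words X; v \<in> words X\<rbrakk> \<Longrightarrow> (u, v) \<in> pres_rel X R"
| cancel: "x \<in> X \<Longrightarrow> ([(x, e), (x, \<not> e)], []) \<in> pres_rel X R"
| refl: "u \<in> words X \<Longrightarrow> (u, u) \<in> pres_rel X R"
| sym: "(u, v) \<in> pres_rel X R \<Longrightarrow> (v, u) \<in> pres_rel X R"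
| trans: "\<lbrakk>(u, v) \<in> pres_rel X R; (v, w) \<in> pres_rel X R\<rbrakk> \<Longrightarrow> (u, w) \<in> pres_rel X R"
| append: "\<lbrakk>(u, u') \<in> pres_rel X R; (v, v') \<in> pres_rel X R\<rbrakk> \<Longrightarrow> (u @ v, u' @ v') \<in> pres_rel X R"

definition presented_group ::
    "'g set \<Rightarrow> ('g word \<times> 'g word) set \<Rightarrow> 'g word set monoid"
  where "presented_group X R =
    \<lparr>carrier = words X // pres_rel X R,
     mult = (\<lambda>A B. \<Union>u\<in>A. \<Union>v\<in>B. pres_rel X R `` {u @ v}),
     one = pres_rel X R `` {[]}\<rparr>"

lemma Nil_in_words [simp]: "[] \<in> words X"
  by (simp add: words_def)

lemma append_in_words [simp]: "u @ v \<in> words X \<longleftrightarrow> u \<in> words X \<and> v \<in> words X"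
  by (auto simp: words_def)

lemma Cons_in_words [simp]: "(x, e) # u \<in> words X \<longleftrightarrow> x \<in> X \<and> u \<in> words X"
  by (auto simp: words_def)

lemma pres_rel_in_words:
  assumes "(u, v) \<in> pres_rel X R" shows "u \<in> words X \<and> v \<in> words X"
  using assms by induction auto

lemma equiv_pres_rel: "equiv (words X) (pres_rel X R)"
proof (rule equivI)
  show "pres_rel X R \<subseteq> words X \<times> words X"
    using pres_rel_in_words by auto
  show "refl_on (words X) (pres_rel X R)"
    by (auto simp: refl_on_def intro: pres_rel.refl)
  show "Relation.sym (pres_rel X R)"
    by (auto simp: sym_def intro: pres_rel.sym)
  show "Relation.trans (pres_rel X R)"
    by (auto simp: trans_def intro: pres_rel.trans)
qed

lemma presented_group_mult:
  assumes "u \<in> words X" "v \<in> words X"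
  shows "pres_rel X R `` {u} \<otimes>\<^bsub>presented_group X R\<^esub> pres_rel X R `` {v} = pres_rel X R `` {u @ v}"
proof -
  have "(\<lambda>u v. pres_rel X R `` {u @ v}) respects2 pres_rel X R"
    by (rule congruent2I')
       (auto intro!: equiv_pres_rel equiv_class_eq[OF equiv_pres_rel] pres_rel.append)
  then show ?thesis
    using assms by (simp add: presented_group_def UN_equiv_class2[OF equiv_pres_rel equiv_pres_rel])
qed

lemma words_inverse:
  assumes "u \<in> words X"
  shows "\<exists>v\<in>words X. (v @ u, []) \<in> pres_rel X R"
  using assms
proof (induction u)
  case Nil
  show ?case by (auto intro!: bexI[of _ "[]"] pres_rel.refl)
next
  case (Cons a u)
  obtain x e where a: "a = (x, e)" by (cases a)
  with Cons obtain v where v: "v \<in> words X" "(v @ u, []) \<in> pres_rel X R" "x \<in> X" "u \<in> words X"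
    by auto
  have "([(x, \<not> e), (x, e)], []) \<in> pres_rel X R"
    using pres_rel.cancel[OF v(3), of "\<not> e"] by simp
  from pres_rel.append[OF this pres_rel.refl[OF v(4)]]
  have "([(x, \<not> e), (x, e)] @ u, u) \<in> pres_rel X R" by simp
  from pres_rel.append[OF pres_rel.refl[OF v(1)] this]
  have "((v @ [(x, \<not> e)]) @ a # u, v @ u) \<in> pres_rel X R" by (simp add: a)
  from pres_rel.trans[OF this v(2)] v(1,3) show ?case
    by (intro bexI[of _ "v @ [(x, \<not> e)]"]) auto
qed

lemma group_presented_group: "group (presented_group X R)"
proof (rule groupI)
  let ?G = "presented_group X R" and ?r = "pres_rel X R"
  have car: "carrier ?G = words X // ?r" and one: "\<one>\<^bsub>?G\<^esub> = ?r `` {[]}"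
    by (simp_all add: presented_group_def)
  show "\<one>\<^bsub>?G\<^esub> \<in> carrier ?G"
    by (simp add: car one quotientI)
  fix A assume "A \<in> carrier ?G"
  then obtain u where u: "u \<in> words X" "A = ?r `` {u}" by (auto simp: car elim: quotientE)
  show "\<one>\<^bsub>?G\<^esub> \<otimes>\<^bsub>?G\<^esub> A = A"
    by (simp add: one u presented_group_mult)
  obtain v where v: "v \<in> words X" "(v @ u, []) \<in> ?r" using words_inverse[OF u(1)] by blast
  show "\<exists>B\<in>carrier ?G. B \<otimes>\<^bsub>?G\<^esub> A = \<one>\<^bsub>?G\<^esub>"
    using v u by (intro bexI[of _ "?r `` {v}"])
      (auto simp: one car presented_group_mult quotientI intro!: equiv_class_eq[OF equiv_pres_rel])
  fix B assume "B \<in> carrier ?G"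
  then obtain v where v: "v \<in> words X" "B = ?r `` {v}" by (auto simp: car elim: quotientE)
  show "A \<otimes>\<^bsub>?G\<^esub> B \<in> carrier ?G"
    by (simp add: car u v presented_group_mult quotientI)
  fix C assume "C \<in> carrier ?G"
  then obtain w where w: "w \<in> words X" "C = ?r `` {w}" by (auto simp: car elim: quotientE)
  show "A \<otimes>\<^bsub>?G\<^esub> B \<otimes>\<^bsub>?G\<^esub> C = A \<otimes>\<^bsub>?G\<^esub> (B \<otimes>\<^bsub>?G\<^esub> C)"
    by (simp add: u v w presented_group_mult)
qed

section \<open>Braid groups\<close>

text \<open>The braid group on \<open>m\<close> strands in Artin's presentation. Its \<open>m - 1\<close> generators are labelled
  \<open>-1, 0, \<dots>, m - 3\<close>, so those of the braid group on \<open>n + 1\<close> strands are labelled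
  \<open>-1, \<dots>, n - 2\<close>.\<close>

definition braid_labels :: "nat \<Rightarrow> int set"
  where "braid_labels m = {-1..int m - 3}"

definition braid_relations :: "nat \<Rightarrow> (int word \<times> int word) set"
  where "braid_relations m =
    {([(i, True), (j, True)], [(j, True), (i, True)]) | i j.
        i \<in> braid_labels m \<and> j \<in> braid_labels m \<and> \<bar>i - j\<bar> \<ge> 2}
    \<union> {([(i, True), (i + 1, True), (i, True)], [(i + 1, True), (i, True), (i + 1, True)]) | i.
        i \<in> braid_labels m \<and> i + 1 \<in> braid_labels m}"

definition braid_group :: "nat \<Rightarrow> int word set monoid"
  where "braid_group m = presented_group (braid_labels m) (braid_relations m)"

definition braid_gen :: "nat \<Rightarrow> int \<Rightarrow> int word set"
  where "braid_gen m k = pres_rel (braid_labels m) (braid_relations m) `` {[(k, True)]}"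

lemma group_braid_group: "group (braid_group m)"
  by (simp add: braid_group_def group_presented_group)

text \<open>The projection to the symmetric group on \<open>{1..m}\<close> sends the generator labelled \<open>k\<close> to the
  transposition of \<open>k + 2\<close> and \<open>k + 3\<close>; this is its own inverse, so the exponent of a
  letter plays no role.\<close>

definition word_perm :: "int word \<Rightarrow> nat \<Rightarrow> nat"
  where "word_perm w = foldr (\<lambda>(k, e) p. transpose (nat (k + 2)) (nat (k + 3)) \<circ> p) w id"

text \<open>The common value of \<open>word_perm\<close> on all words representing the given braid; see
  \<open>braid_perm_hom\<close> below.\<close>

definition braid_perm :: "int word set \<Rightarrow> nat \<Rightarrow> nat"
  where "braid_perm b = the_elem (word_perm ` b)"

lemma word_perm_Nil [simp]: "word_perm [] = id"
  by (simp add: word_perm_def)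

lemma word_perm_Cons [simp]:
  "word_perm ((k, e) # w) = transpose (nat (k + 2)) (nat (k + 3)) \<circ> word_perm w"
  by (simp add: word_perm_def)

lemma word_perm_append: "word_perm (u @ v) = word_perm u \<circ> word_perm v"
  by (induction u) (auto simp: comp_assoc)

lemma word_perm_permutes:
  assumes "w \<in> words (braid_labels m)" shows "word_perm w permutes {1..m}"
  using assms
proof (induction w)
  case (Cons a w)
  obtain k e where a: "a = (k, e)" by (cases a)
  with Cons have "k \<in> braid_labels m" "word_perm w permutes {1..m}" by auto
  moreover from this(1) have "transpose (nat (k + 2)) (nat (k + 3)) permutes {1..m}"
    by (intro permutes_swap_id) (auto simp: braid_labels_def)
  ultimately show ?case
    unfolding a word_perm_Cons by (intro permutes_compose)
qed (simp add: permutes_id)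

lemma word_perm_cong:
  assumes "(u, v) \<in> pres_rel (braid_labels m) (braid_relations m)"
  shows "word_perm u = word_perm v"
  using assms
proof induction
  case (relation u v)
  then show ?case
  proof (auto simp: braid_relations_def, goal_cases)
    case (1 i j)
    then have "nat (i + 2) \<noteq> nat (j + 2)" "nat (i + 2) \<noteq> nat (j + 3)"
      "nat (i + 3) \<noteq> nat (j + 2)" "nat (i + 3) \<noteq> nat (j + 3)"
      by (auto simp: braid_labels_def abs_if split: if_splits)
    then show ?case by (auto simp: fun_eq_iff transpose_def)
  next
    case (2 i)
    then have "nat (i + 2) \<noteq> nat (i + 3)" "nat (i + 3) \<noteq> nat (i + 4)" "nat (i + 2) \<noteq> nat (i + 4)"
      by (auto simp: braid_labels_def)
    then show ?case by (auto simp: fun_eq_iff transpose_def add.commute)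
  qed
qed (auto simp: word_perm_append comp_assoc[symmetric])

lemma braid_perm_class:
  assumes "w \<in> words (braid_labels m)"
  shows "braid_perm (pres_rel (braid_labels m) (braid_relations m) `` {w}) = word_perm w"
proof -
  have "word_perm ` (pres_rel (braid_labels m) (braid_relations m) `` {w}) = {word_perm w}"
    using assms by (auto dest: word_perm_cong intro!: image_eqI[of _ _ w] pres_rel.refl)
  then show ?thesis by (simp add: braid_perm_def)
qed

lemma braid_perm_hom: "braid_perm \<in> hom (braid_group m) (sym_group m)"
proof (rule homI)
  let ?r = "pres_rel (braid_labels m) (braid_relations m)"
  fix A assume "A \<in> carrier (braid_group m)"
  then obtain u where u: "u \<in> words (braid_labels m)" "A = ?r `` {u}"
    by (auto simp: braid_group_def presented_group_def elim: quotientE)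
  show "braid_perm A \<in> carrier (sym_group m)"
    using word_perm_permutes[OF u(1)] by (simp add: u braid_perm_class sym_group_carrier)
  fix B assume "B \<in> carrier (braid_group m)"
  then obtain v where v: "v \<in> words (braid_labels m)" "B = ?r `` {v}"
    by (auto simp: braid_group_def presented_group_def elim: quotientE)
  show "braid_perm (A \<otimes>\<^bsub>braid_group m\<^esub> B) = braid_perm A \<otimes>\<^bsub>sym_group m\<^esub> braid_perm B"
    by (simp add: u v braid_group_def presented_group_mult braid_perm_class word_perm_append
        sym_group_mult)
qed

text \<open>The kernel of the composite of the projection to the symmetric group with the sign, where
  \<open>sign_img\<close> is the multiplicative group \<open>{-1, 1}\<close>.\<close>

definition even_braids :: "nat \<Rightarrow> int word set set"
  where "even_braids m = kernel (braid_group m) sign_img (\<lambda>b. sign (braid_perm b))"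

section \<open>Braided simplicial groups\<close>

text \<open>The face \<open>d n j\<close> and the degeneracy \<open>s n j\<close> are indexed by the dimension \<open>n\<close> of their
  domain; they matter only on the carrier of \<open>G n\<close>, for \<open>j \<le> n\<close> (and \<open>n > 0\<close> for faces).\<close>

locale simplicial_group =
  fixes G :: "nat \<Rightarrow> ('a, 'b) monoid_scheme"
    and d :: "nat \<Rightarrow> nat \<Rightarrow> 'a \<Rightarrow> 'a"
    and s :: "nat \<Rightarrow> nat \<Rightarrow> 'a \<Rightarrow> 'a"
  assumes group_G: "group (G n)"
    and face_hom: "j \<le> Suc n \<Longrightarrow> d (Suc n) j \<in> hom (G (Suc n)) (G n)"
    and degen_hom: "j \<le> n \<Longrightarrow> s n j \<in> hom (G n) (G (Suc n))"
    and face_face: "\<lbrakk>x \<in> carrier (G (Suc (Suc n))); i < j; j \<le> Suc (Suc n)\<rbrakk> \<Longrightarrow>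
      d (Suc n) i (d (Suc (Suc n)) j x) = d (Suc n) (j - 1) (d (Suc (Suc n)) i x)"
    and degen_degen: "\<lbrakk>x \<in> carrier (G n); i \<le> j; j \<le> n\<rbrakk> \<Longrightarrow>
      s (Suc n) i (s n j x) = s (Suc n) (Suc j) (s n i x)"
    and face_degen_less: "\<lbrakk>x \<in> carrier (G (Suc n)); i < j; j \<le> Suc n\<rbrakk> \<Longrightarrow>
      d (Suc (Suc n)) i (s (Suc n) j x) = s n (j - 1) (d (Suc n) i x)"
    and face_degen_eq: "\<lbrakk>x \<in> carrier (G n); j \<le> n\<rbrakk> \<Longrightarrow> d (Suc n) j (s n j x) = x"
    and face_degen_Suc: "\<lbrakk>x \<in> carrier (G n); j \<le> n\<rbrakk> \<Longrightarrow> d (Suc n) (Suc j) (s n j x) = x"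
    and face_degen_greater: "\<lbrakk>x \<in> carrier (G (Suc n)); Suc j < i; i \<le> Suc (Suc n)\<rbrakk> \<Longrightarrow>
      d (Suc (Suc n)) i (s (Suc n) j x) = s n j (d (Suc n) (i - 1) x)"

text \<open>\<open>act n\<close> is the action of the braid group on \<open>n + 1\<close> strands on \<open>G n\<close>, and \<open>\<sigma> n k\<close> below is
  the action of its generator labelled \<open>k\<close>. Multiplication in \<open>AutoGroup\<close> is composition from
  right to left. There are no generators when \<open>n = 0\<close>, so the face conditions concern only
  dimensions \<open>Suc n\<close>.\<close>

locale braided_simplicial_group = simplicial_group G d s
  for G :: "nat \<Rightarrow> ('a, 'b) monoid_scheme"
    and d :: "nat \<Rightarrow> nat \<Rightarrow> 'a \<Rightarrow> 'a"
    and s :: "nat \<Rightarrow> nat \<Rightarrow> 'a \<Rightarrow> 'a" +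
  fixes act :: "nat \<Rightarrow> int word set \<Rightarrow> 'a \<Rightarrow> 'a"
    and \<sigma> :: "nat \<Rightarrow> int \<Rightarrow> 'a \<Rightarrow> 'a"
  defines "\<sigma> n k \<equiv> act n (braid_gen (Suc n) k)"
  assumes act_hom: "act n \<in> hom (braid_group (Suc n)) (AutoGroup (G n))"
    and face_braid_le:
      "\<lbrakk>x \<in> carrier (G (Suc n)); k \<in> braid_labels (Suc (Suc n)); j \<le> Suc n; int j \<le> k\<rbrakk> \<Longrightarrow>
        d (Suc n) j (\<sigma> (Suc n) k x) = \<sigma> n (k - 1) (d (Suc n) j x)"
    and face_braid_1:
      "\<lbrakk>x \<in> carrier (G (Suc n)); k \<in> braid_labels (Suc (Suc n))\<rbrakk> \<Longrightarrow>
        d (Suc n) (nat (k + 1)) (\<sigma> (Suc n) k x) = d (Suc n) (nat (k + 2)) x"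
    and face_braid_2:
      "\<lbrakk>x \<in> carrier (G (Suc n)); k \<in> braid_labels (Suc (Suc n))\<rbrakk> \<Longrightarrow>
        d (Suc n) (nat (k + 2)) (\<sigma> (Suc n) k x) = d (Suc n) (nat (k + 1)) x"
    and face_braid_greater:
      "\<lbrakk>x \<in> carrier (G (Suc n)); k \<in> braid_labels (Suc (Suc n)); j \<le> Suc n; int j > k + 2\<rbrakk> \<Longrightarrow>
        d (Suc n) j (\<sigma> (Suc n) k x) = \<sigma> n k (d (Suc n) j x)"
    and degen_braid_le:
      "\<lbrakk>x \<in> carrier (G n); k \<in> braid_labels (Suc n); j \<le> n; int j \<le> k\<rbrakk> \<Longrightarrow>
        s n j (\<sigma> n k x) = \<sigma> (Suc n) (k + 1) (s n j x)"
    and degen_braid_1: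
      "\<lbrakk>x \<in> carrier (G n); k \<in> braid_labels (Suc n)\<rbrakk> \<Longrightarrow>
        s n (nat (k + 1)) (\<sigma> n k x) = \<sigma> (Suc n) (k + 1) (\<sigma> (Suc n) k (s n (nat (k + 2)) x))"
    and degen_braid_2:
      "\<lbrakk>x \<in> carrier (G n); k \<in> braid_labels (Suc n)\<rbrakk> \<Longrightarrow>
        s n (nat (k + 2)) (\<sigma> n k x) = \<sigma> (Suc n) k (\<sigma> (Suc n) (k + 1) (s n (nat (k + 1)) x))"
    and degen_braid_greater:
      "\<lbrakk>x \<in> carrier (G n); k \<in> braid_labels (Suc n); j \<le> n; int j > k + 2\<rbrakk> \<Longrightarrow>
        s n j (\<sigma> n k x) = \<sigma> (Suc n) k (s n j x)"

text \<open>There are no faces in dimension \<open>0\<close>, so all of \<open>G 0\<close> consists of cycles.\<close>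

definition cycles ::
    "(nat \<Rightarrow> ('a, 'b) monoid_scheme) \<Rightarrow> (nat \<Rightarrow> nat \<Rightarrow> 'a \<Rightarrow> 'a) \<Rightarrow> nat \<Rightarrow> 'a set"
  where "cycles G d n =
    {x \<in> carrier (G n). n > 0 \<longrightarrow> (\<forall>j\<le>n. d n j x = \<one>\<^bsub>G (n - 1)\<^esub>)}"

definition boundaries ::
    "(nat \<Rightarrow> ('a, 'b) monoid_scheme) \<Rightarrow> (nat \<Rightarrow> nat \<Rightarrow> 'a \<Rightarrow> 'a) \<Rightarrow> nat \<Rightarrow> 'a set"
  where "boundaries G d n =
    {d (Suc n) 0 x | x. x \<in> carrier (G (Suc n)) \<and>
       (\<forall>j. 0 < j \<and> j \<le> Suc n \<longrightarrow> d (Suc n) j x = \<one>\<^bsub>G n\<^esub>)}"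

definition homotopy_group ::
    "(nat \<Rightarrow> ('a, 'b) monoid_scheme) \<Rightarrow> (nat \<Rightarrow> nat \<Rightarrow> 'a \<Rightarrow> 'a) \<Rightarrow> nat \<Rightarrow> 'a set monoid"
  where "homotopy_group G d n = (G n)\<lparr>carrier := cycles G d n\<rparr> Mod boundaries G d n"

definition homotopic ::
    "(nat \<Rightarrow> ('a, 'b) monoid_scheme) \<Rightarrow> (nat \<Rightarrow> nat \<Rightarrow> 'a \<Rightarrow> 'a) \<Rightarrow> nat \<Rightarrow> 'a \<Rightarrow> 'a \<Rightarrow> bool"
  where "homotopic G d n x y \<longleftrightarrow> x \<otimes>\<^bsub>G n\<^esub> inv\<^bsub>G n\<^esub> y \<in> boundaries G d n"

definition cycle_stabilizer ::
    "(nat \<Rightarrow> ('a, 'b) monoid_scheme) \<Rightarrow> (nat \<Rightarrow> nat \<Rightarrow> 'a \<Rightarrow> 'a)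
      \<Rightarrow> (nat \<Rightarrow> int word set \<Rightarrow> 'a \<Rightarrow> 'a) \<Rightarrow> nat \<Rightarrow> int word set set"
  where "cycle_stabilizer G d act n =
    {b \<in> carrier (braid_group (Suc n)). \<forall>x\<in>cycles G d n. homotopic G d n (act n b x) x}"

end

theory Submission
  imports Defs
begin

text \<open>Both claims follow from one fact: a braid \<open>b\<close> acts on \<open>\<pi>\<^sub>n(G)\<close> by \<open>x \<mapsto> x\<^bsup>sign b\<^esup>\<close>. Given this,
  even braids fix all homotopy classes, while an odd braid does so exactly if every class equals
  its inverse, that is, if \<open>2 \<cdot> \<pi>\<^sub>n(G) = 0\<close>. So one odd braid in the stabilizer puts all braids
  into it. In dimension \<open>n \<ge> 1\<close> odd braids exist, so that the stabilizer detects whether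
  \<open>2 \<cdot> \<pi>\<^sub>n(G) = 0\<close>.

  The fact needs to be known for the generators only, where it says that \<open>\<sigma>\<^sub>k x \<cdot> x\<close> is a boundary
  for each cycle \<open>x\<close> (\<open>sigma_mult_boundary\<close>). The element \<open>\<sigma>\<^sub>k\<^sub>+\<^sub>1 s\<^sub>k\<^sub>+\<^sub>1 x\<close> of \<open>G\<^sub>n\<^sub>+\<^sub>1\<close> has only two
  nontrivial faces, \<open>\<sigma>\<^sub>k x\<close> in position \<open>k + 1\<close> and \<open>x\<close> in position \<open>k + 3\<close>. Multiplication by
  degeneracies of \<open>x\<close> and its inverse merges them into the single face \<open>\<sigma>\<^sub>k x \<cdot> x\<close>, and an element
  with a single nontrivial face exhibits that face as a boundary, whatever its position
  (\<open>single_face_boundary\<close>). Since the generators map cycles to cycles bijectively, the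
  inverses of generators invert homotopy classes as well, and induction on words gives
  all braids (\<open>homotopy_class_word\<close>).\<close>

section \<open>Cycles and boundaries in a simplicial group\<close>

context simplicial_group
begin

lemma face_group_hom: "j \<le> Suc n \<Longrightarrow> group_hom (G (Suc n)) (G n) (d (Suc n) j)"
  by (simp add: group_hom_def group_hom_axioms_def group_G face_hom)

lemma degen_group_hom: "j \<le> n \<Longrightarrow> group_hom (G n) (G (Suc n)) (s n j)"
  by (simp add: group_hom_def group_hom_axioms_def group_G degen_hom)

lemma degen_closed: "\<lbrakk>j \<le> n; x \<in> carrier (G n)\<rbrakk> \<Longrightarrow> s n j x \<in> carrier (G (Suc n))"
  by (rule group_hom.hom_closed[OF degen_group_hom])

lemma face_one: "j \<le> Suc n \<Longrightarrow> d (Suc n) j \<one>\<^bsub>G (Suc n)\<^esub> = \<one>\<^bsub>G n\<^esub>"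
  by (rule group_hom.hom_one[OF face_group_hom])

lemma degen_one: "j \<le> n \<Longrightarrow> s n j \<one>\<^bsub>G n\<^esub> = \<one>\<^bsub>G (Suc n)\<^esub>"
  by (rule group_hom.hom_one[OF degen_group_hom])

lemma face_mult:
  assumes "j \<le> Suc n" "x \<in> carrier (G (Suc n))" "y \<in> carrier (G (Suc n))"
  shows "d (Suc n) j (x \<otimes>\<^bsub>G (Suc n)\<^esub> y) = d (Suc n) j x \<otimes>\<^bsub>G n\<^esub> d (Suc n) j y"
  using assms by (intro group_hom.hom_mult[OF face_group_hom])

lemma cycles_in_carrier: "x \<in> cycles G d n \<Longrightarrow> x \<in> carrier (G n)"
  by (simp add: cycles_def)

lemma cycles_mult:
  assumes "x \<in> cycles G d n" "y \<in> cycles G d n"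
  shows "x \<otimes>\<^bsub>G n\<^esub> y \<in> cycles G d n"
proof -
  interpret N: group "G n" by (rule group_G)
  have "x \<otimes>\<^bsub>G n\<^esub> y \<in> carrier (G n)" using assms by (simp add: cycles_in_carrier)
  moreover have "d n j (x \<otimes>\<^bsub>G n\<^esub> y) = \<one>\<^bsub>G p\<^esub>" if "n = Suc p" "j \<le> n" for p j
  proof -
    interpret P: group "G p" by (rule group_G)
    show ?thesis using assms that by (simp add: cycles_def face_mult)
  qed
  ultimately show ?thesis by (cases n) (auto simp: cycles_def)
qed

lemma cycles_inv:
  assumes "x \<in> cycles G d n"
  shows "inv\<^bsub>G n\<^esub> x \<in> cycles G d n"
proof -
  interpret N: group "G n" by (rule group_G)
  have "inv\<^bsub>G n\<^esub> x \<in> carrier (G n)" using assms by (simp add: cycles_in_carrier)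
  moreover have "d n j (inv\<^bsub>G n\<^esub> x) = \<one>\<^bsub>G p\<^esub>" if "n = Suc p" "j \<le> n" for p j
  proof -
    interpret P: group "G p" by (rule group_G)
    show ?thesis using assms that
      by (simp add: cycles_def group_hom.hom_inv[OF face_group_hom])
  qed
  ultimately show ?thesis by (cases n) (auto simp: cycles_def)
qed

lemma face_degen_cycle:
  assumes x: "x \<in> cycles G d n" and j: "j \<le> n" and i: "i \<le> Suc n"
  shows "d (Suc n) i (s n j x) = (if i = j \<or> i = Suc j then x else \<one>\<^bsub>G n\<^esub>)"
proof -
  note xc = cycles_in_carrier[OF x]
  consider "i = j" | "i = Suc j" | "i < j" | "Suc j < i" by linarith
  then show ?thesis
  proof cases
    case 3
    then obtain p where n: "n = Suc p" using j by (cases n) auto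
    have "d n i x = \<one>\<^bsub>G p\<^esub>" using x 3 j n by (simp add: cycles_def)
    then show ?thesis
      using 3 j xc face_degen_less[of x p i j] degen_one[of "j - 1" p] by (auto simp: n)
  next
    case 4
    then obtain p where n: "n = Suc p" using i by (cases n) auto
    have "d n (i - 1) x = \<one>\<^bsub>G p\<^esub>" using x 4 i n by (simp add: cycles_def)
    then show ?thesis
      using 4 i xc face_degen_greater[of x p j i] degen_one[of j p] by (auto simp: n)
  qed (use xc j in \<open>auto simp: face_degen_eq face_degen_Suc\<close>)
qed

text \<open>The boundaries are the image of an intersection of kernels, a normal subgroup of
  \<open>G\<^sub>n\<^sub>+\<^sub>1\<close>, under the face \<open>d\<^sub>0\<close>, which is surjective with section \<open>s\<^sub>0\<close>. Normality in all of \<open>G\<^sub>n\<close>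
  makes it possible to compare arbitrary elements, not only cycles, in one quotient group.\<close>

lemma boundaries_normal: "boundaries G d n \<lhd> G n"
proof -
  interpret N: group "G n" by (rule group_G)
  interpret M: group "G (Suc n)" by (rule group_G)
  interpret d0: group_hom "G (Suc n)" "G n" "d (Suc n) 0" by (rule face_group_hom) simp
  let ?K = "{x \<in> carrier (G (Suc n)). \<forall>j. 0 < j \<and> j \<le> Suc n \<longrightarrow> d (Suc n) j x = \<one>\<^bsub>G n\<^esub>}"
  have "subgroup ?K (G (Suc n))"
    by (rule M.subgroupI)
       (auto simp: face_mult face_one group_hom.hom_inv[OF face_group_hom]
         intro!: exI[of _ "\<one>\<^bsub>G (Suc n)\<^esub>"])
  then have K: "?K \<lhd> G (Suc n)"
    by (rule M.normal_invI) (auto simp: face_mult group_hom.hom_inv[OF face_group_hom]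
        group_hom.hom_closed[OF face_group_hom])
  have "x \<in> d (Suc n) 0 ` carrier (G (Suc n))" if "x \<in> carrier (G n)" for x
    using that by (intro image_eqI[where x = "s n 0 x"]) (simp_all add: face_degen_eq degen_closed)
  then have "d (Suc n) 0 ` carrier (G (Suc n)) = carrier (G n)"
    by auto
  from normal.surj_hom_normal_subgroup[OF K d0.group_hom_axioms this]
  have "d (Suc n) 0 ` ?K \<lhd> G n" .
  moreover have "d (Suc n) 0 ` ?K = boundaries G d n"
    by (auto simp: boundaries_def)
  ultimately show ?thesis by simp
qed

text \<open>Boundaries are defined through the face \<open>d\<^sub>0\<close>, but a filler in any other position is as
  good. If \<open>z\<close> is the only nontrivial face, in position \<open>m + 1\<close>, then multiplying the
  filler by the degeneracy \<open>s\<^sub>m\<close> of the inverse of \<open>z\<close> moves that face down to position \<open>m\<close> and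
  inverts it.\<close>

lemma single_face_boundary:
  assumes "m \<le> Suc n" "z \<in> cycles G d n" "w \<in> carrier (G (Suc n))"
    and "\<And>j. j \<le> Suc n \<Longrightarrow> d (Suc n) j w = (if j = m then z else \<one>\<^bsub>G n\<^esub>)"
  shows "z \<in> boundaries G d n"
  using assms
proof (induction m arbitrary: z w)
  case 0
  then show ?case by (auto simp: boundaries_def intro!: exI[of _ w])
next
  case (Suc m)
  interpret N: group "G n" by (rule group_G)
  interpret M: group "G (Suc n)" by (rule group_G)
  interpret B: normal "boundaries G d n" "G n" by (rule boundaries_normal)
  let ?z = "inv\<^bsub>G n\<^esub> z"
  let ?w = "w \<otimes>\<^bsub>G (Suc n)\<^esub> s n m ?z"
  have m: "m \<le> n" using Suc.prems(1) by simp
  have z: "z \<in> carrier (G n)" "?z \<in> cycles G d n"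
    using Suc.prems(2) by (auto intro: cycles_in_carrier cycles_inv)
  have sz: "s n m ?z \<in> carrier (G (Suc n))" using z m by (simp add: degen_closed)
  have "?z \<in> boundaries G d n"
  proof (rule Suc.IH)
    show "m \<le> Suc n" "?z \<in> cycles G d n" "?w \<in> carrier (G (Suc n))"
      using m z sz Suc.prems(3) by auto
    fix j assume "j \<le> Suc n"
    then show "d (Suc n) j ?w = (if j = m then ?z else \<one>\<^bsub>G n\<^esub>)"
      using Suc.prems(3,4) m z sz by (auto simp: face_mult face_degen_cycle)
  qed
  from B.m_inv_closed[OF this] show ?case using z by simp
qed

definition homotopy_class :: "nat \<Rightarrow> 'a \<Rightarrow> 'a set"
  where "homotopy_class n x = boundaries G d n #>\<^bsub>G n\<^esub> x"

lemma homotopy_class_hom: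
  "group_hom (G n) (G n Mod boundaries G d n) (homotopy_class n)"
proof -
  interpret normal "boundaries G d n" "G n" by (rule boundaries_normal)
  show ?thesis
    unfolding homotopy_class_def group_hom_def group_hom_axioms_def
    by (simp add: group_G factorgroup_is_group r_coset_hom_Mod)
qed

lemma homotopic_iff:
  assumes "x \<in> carrier (G n)" "y \<in> carrier (G n)"
  shows "homotopic G d n x y \<longleftrightarrow> homotopy_class n x = homotopy_class n y"
proof -
  interpret normal "boundaries G d n" "G n" by (rule boundaries_normal)
  show ?thesis
    unfolding homotopic_def homotopy_class_def
    using assms rcos_module[OF group_G, of y x]
    by (metis repr_independence repr_independenceD subgroup_axioms)
qed

lemma carrier_homotopy_group:
  "carrier (homotopy_group G d n) = homotopy_class n ` cycles G d n"
  by (auto simp: homotopy_group_def FactGroup_def RCOSETS_def homotopy_class_def r_coset_def)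

text \<open>The homotopy group is a subgroup of the quotient of the whole group \<open>G\<^sub>n\<close> by the boundaries,
  so powers may be computed there.\<close>

lemma homotopy_group_square:
  fixes x :: 'a
  assumes x: "x \<in> carrier (G n)"
  shows "homotopy_class n x [^]\<^bsub>homotopy_group G d n\<^esub> (2::nat) = \<one>\<^bsub>homotopy_group G d n\<^esub>
    \<longleftrightarrow> homotopy_class n (inv\<^bsub>G n\<^esub> x) = homotopy_class n x"
proof -
  let ?Q = "G n Mod boundaries G d n"
  interpret q: group_hom "G n" ?Q "homotopy_class n" by (rule homotopy_class_hom)
  have ops: "mult (homotopy_group G d n) = mult ?Q" "\<one>\<^bsub>homotopy_group G d n\<^esub> = \<one>\<^bsub>?Q\<^esub>"
    by (auto simp: homotopy_group_def FactGroup_def set_mult_def fun_eq_iff)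
  have c: "homotopy_class n x \<in> carrier ?Q" using x by simp
  have "homotopy_class n x [^]\<^bsub>homotopy_group G d n\<^esub> (2::nat)
      = homotopy_class n x [^]\<^bsub>?Q\<^esub> (2::nat)"
    using ops by (simp add: nat_pow_def)
  also have "\<dots> = homotopy_class n x \<otimes>\<^bsub>?Q\<^esub> homotopy_class n x"
    using c by (simp add: numeral_2_eq_2 del: mult_FactGroup one_FactGroup)
  also have "\<dots> = \<one>\<^bsub>?Q\<^esub> \<longleftrightarrow> inv\<^bsub>?Q\<^esub> homotopy_class n x = homotopy_class n x"
    using c by (metis q.H.inv_equality q.H.r_inv)
  finally show ?thesis using x ops by simp
qed

end

section \<open>Braids as words\<close>

definition braid_class :: "nat \<Rightarrow> int word \<Rightarrow> int word set"
  where "braid_class m w = pres_rel (braid_labels m) (braid_relations m) `` {w}"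

lemma braid_gen_eq_class: "braid_gen m k = braid_class m [(k, True)]"
  by (simp add: braid_gen_def braid_class_def)

lemma carrier_braid_group: "carrier (braid_group m) = braid_class m ` words (braid_labels m)"
  by (auto simp: braid_group_def presented_group_def quotient_def braid_class_def)

lemma braid_class_append:
  assumes "u \<in> words (braid_labels m)" "v \<in> words (braid_labels m)"
  shows "braid_class m (u @ v) = braid_class m u \<otimes>\<^bsub>braid_group m\<^esub> braid_class m v"
  using assms by (simp add: braid_class_def braid_group_def presented_group_mult)

lemma braid_class_Nil: "braid_class m [] = \<one>\<^bsub>braid_group m\<^esub>"
  by (simp add: braid_class_def braid_group_def presented_group_def)

lemma braid_class_cancel:
  assumes "k \<in> braid_labels m"
  shows "braid_class m [(k, e)] \<otimes>\<^bsub>braid_group m\<^esub> braid_class m [(k, \<not> e)] = \<one>\<^bsub>braid_group m\<^esub>"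
proof -
  have "braid_class m ([(k, e)] @ [(k, \<not> e)]) = braid_class m []"
    unfolding braid_class_def
    by (rule equiv_class_eq[OF equiv_pres_rel]) (simp add: pres_rel.cancel assms)
  then show ?thesis using assms by (simp only: braid_class_Nil) (subst braid_class_append[symmetric], auto)
qed

lemma sign_word_perm_Cons:
  assumes "k \<in> braid_labels m" "w \<in> words (braid_labels m)"
  shows "sign (word_perm ((k, e) # w)) = - sign (word_perm w)"
proof -
  have "permutation (word_perm w)"
    by (rule permutes_imp_permutation[OF _ word_perm_permutes[OF assms(2)]]) simp
  moreover have "nat (k + 2) \<noteq> nat (k + 3)"
    using assms(1) by (auto simp: braid_labels_def)
  ultimately show ?thesis
    by (simp add: sign_compose permutation_swap_id sign_swap_id)
qed

lemma sign_braid_perm_class: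
  "w \<in> words (braid_labels m) \<Longrightarrow> sign (braid_perm (braid_class m w)) = sign (word_perm w)"
  by (simp add: braid_class_def braid_perm_class)

lemma mem_even_braids_iff:
  "b \<in> even_braids m \<longleftrightarrow> b \<in> carrier (braid_group m) \<and> sign (braid_perm b) = 1"
  by (simp add: even_braids_def kernel_def sign_img_def)

section \<open>Braids act on homotopy classes of cycles by their sign\<close>

context braided_simplicial_group
begin

lemma act_auto: "b \<in> carrier (braid_group (Suc n)) \<Longrightarrow> act n b \<in> auto (G n)"
  using hom_in_carrier[OF act_hom] by (simp add: AutoGroup_def)

lemma act_group_hom: "b \<in> carrier (braid_group (Suc n)) \<Longrightarrow> group_hom (G n) (G n) (act n b)"
  using act_auto[of b n] by (simp add: group_hom_def group_hom_axioms_def group_G auto_def)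

lemma act_inj: "b \<in> carrier (braid_group (Suc n)) \<Longrightarrow> inj_on (act n b) (carrier (G n))"
  using act_auto[of b n] by (simp add: auto_def Bij_def bij_betw_def)

lemma act_closed:
  "\<lbrakk>b \<in> carrier (braid_group (Suc n)); x \<in> carrier (G n)\<rbrakk> \<Longrightarrow> act n b x \<in> carrier (G n)"
  by (rule group_hom.hom_closed[OF act_group_hom])

lemma act_mult:
  assumes "b \<in> carrier (braid_group (Suc n))" "c \<in> carrier (braid_group (Suc n))"
    and "x \<in> carrier (G n)"
  shows "act n (b \<otimes>\<^bsub>braid_group (Suc n)\<^esub> c) x = act n b (act n c x)"
  using hom_mult[OF act_hom assms(1,2)] act_auto[OF assms(1)] act_auto[OF assms(2)] assms(3)
  by (simp add: AutoGroup_def BijGroup_def auto_def compose_eq)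

lemma act_one:
  assumes "x \<in> carrier (G n)" shows "act n \<one>\<^bsub>braid_group (Suc n)\<^esub> x = x"
proof -
  interpret group "G n" by (rule group_G)
  have "act n \<one>\<^bsub>braid_group (Suc n)\<^esub> = \<one>\<^bsub>AutoGroup (G n)\<^esub>"
    using act_hom group_braid_group AutoGroup by (rule hom_one)
  then show ?thesis using assms by (simp add: AutoGroup_def BijGroup_def)
qed

lemma gen_in_carrier:
  "k \<in> braid_labels m \<Longrightarrow> braid_gen m k \<in> carrier (braid_group m)"
  by (auto simp: braid_gen_eq_class carrier_braid_group)

lemma sigma_closed:
  "\<lbrakk>k \<in> braid_labels (Suc n); x \<in> carrier (G n)\<rbrakk> \<Longrightarrow> \<sigma> n k x \<in> carrier (G n)"
  by (simp add: \<sigma>_def act_closed gen_in_carrier)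

lemma sigma_eq_one_iff:
  assumes "k \<in> braid_labels (Suc n)" "x \<in> carrier (G n)"
  shows "\<sigma> n k x = \<one>\<^bsub>G n\<^esub> \<longleftrightarrow> x = \<one>\<^bsub>G n\<^esub>"
proof -
  interpret f: group_hom "G n" "G n" "\<sigma> n k"
    using assms by (simp add: \<sigma>_def act_group_hom gen_in_carrier)
  have "inj_on (\<sigma> n k) (carrier (G n))"
    using assms by (simp add: \<sigma>_def act_inj gen_in_carrier)
  then show ?thesis using assms(2) f.hom_one by (metis f.one_closed inj_on_eq_iff)
qed

text \<open>A generator permutes the faces up to automorphisms, so it preserves and reflects the property
  that all of them are trivial. The converse direction is what makes inverse generators preserve
  cycles.\<close>

lemma sigma_cycle_iff:
  assumes k: "k \<in> braid_labels (Suc n)" and x: "x \<in> carrier (G n)"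
  shows "\<sigma> n k x \<in> cycles G d n \<longleftrightarrow> x \<in> cycles G d n"
proof (cases n)
  case 0
  then show ?thesis using k by (simp add: braid_labels_def)
next
  case (Suc p)
  have kp: "k \<in> braid_labels (Suc (Suc p))" and xp: "x \<in> carrier (G (Suc p))"
    using k x by (simp_all add: Suc)
  have k1: "- 1 \<le> k" "k + 1 \<le> int p" using kp by (auto simp: braid_labels_def)
  define a b where "a = nat (k + 1)" and "b = nat (k + 2)"
  have ab: "a \<le> Suc p" "b \<le> Suc p" using k1 by (auto simp: a_def b_def)
  have dx: "d (Suc p) j x \<in> carrier (G p)" if "j \<le> Suc p" for j
    using that xp by (rule group_hom.hom_closed[OF face_group_hom])
  have swap: "d (Suc p) a (\<sigma> (Suc p) k x) = d (Suc p) b x"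
    "d (Suc p) b (\<sigma> (Suc p) k x) = d (Suc p) a x"
    using face_braid_1[OF xp kp] face_braid_2[OF xp kp] by (simp_all add: a_def b_def)
  have other: "d (Suc p) j (\<sigma> (Suc p) k x) = \<one>\<^bsub>G p\<^esub> \<longleftrightarrow> d (Suc p) j x = \<one>\<^bsub>G p\<^esub>"
    if j: "j \<le> Suc p" "j \<noteq> a" "j \<noteq> b" for j
  proof -
    consider "int j \<le> k" | "int j > k + 2"
      using j k1 by (auto simp: a_def b_def) linarith
    then show ?thesis
    proof cases
      case 1
      then have "k - 1 \<in> braid_labels (Suc p)" using k1 by (auto simp: braid_labels_def)
      then show ?thesis
        using face_braid_le[OF xp kp j(1) 1] sigma_eq_one_iff dx[OF j(1)] by simp
    next
      case 2
      then have "k \<in> braid_labels (Suc p)" using k1 j(1) by (auto simp: braid_labels_def)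
      then show ?thesis
        using face_braid_greater[OF xp kp j(1) 2] sigma_eq_one_iff dx[OF j(1)] by simp
    qed
  qed
  have "(\<forall>j\<le>Suc p. d (Suc p) j (\<sigma> (Suc p) k x) = \<one>\<^bsub>G p\<^esub>)
      \<longleftrightarrow> (\<forall>j\<le>Suc p. d (Suc p) j x = \<one>\<^bsub>G p\<^esub>)"
    using swap other ab by metis
  then show ?thesis
    using sigma_closed[OF kp xp] xp by (simp add: cycles_def Suc)
qed

text \<open>Every degeneracy of a cycle \<open>x\<close> has two adjacent faces equal to \<open>x\<close>. Acting by
  \<open>\<sigma>\<^sub>m\<close> on \<open>s\<^sub>m x\<close> pulls them apart: the faces in positions \<open>m\<close> and \<open>m + 2\<close> become
  \<open>\<sigma>\<^sub>m\<^sub>-\<^sub>1 x\<close> and \<open>x\<close>, and all others are trivial. As these positions have the same parity, the two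
  cycles contribute with the same sign, and their product is a boundary.\<close>

lemma sigma_mult_boundary:
  assumes k: "k \<in> braid_labels (Suc n)" and x: "x \<in> cycles G d n"
  shows "\<sigma> n k x \<otimes>\<^bsub>G n\<^esub> x \<in> boundaries G d n"
proof -
  interpret N: group "G n" by (rule group_G)
  interpret M: group "G (Suc n)" by (rule group_G)
  define m where "m = nat (k + 1)"
  have m: "int m = k + 1" and mn: "Suc m \<le> n"
    using k by (auto simp: m_def braid_labels_def)
  have m_label: "int m \<in> braid_labels (Suc (Suc n))" using mn by (auto simp: braid_labels_def)
  let ?y = "\<sigma> n k x" and ?xi = "inv\<^bsub>G n\<^esub> x"
  have xc: "x \<in> carrier (G n)" using x by (rule cycles_in_carrier)
  have y: "?y \<in> cycles G d n" using sigma_cycle_iff[OF k xc] x by simp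
  note yc = cycles_in_carrier[OF y]
  have xi: "?xi \<in> cycles G d n" using x by (rule cycles_inv)
  define v where "v = \<sigma> (Suc n) (int m) (s n m x)"
  have sx: "s n m x \<in> carrier (G (Suc n))" using mn xc by (simp add: degen_closed)
  have vc: "v \<in> carrier (G (Suc n))"
    unfolding v_def using m_label sx by (rule sigma_closed)
  have dv: "d (Suc n) j v = (if j = m then ?y else if j = Suc (Suc m) then x else \<one>\<^bsub>G n\<^esub>)"
    if j: "j \<le> Suc n" for j
  proof -
    have lab: "int m - 1 \<in> braid_labels (Suc n)" using k m by simp
    consider "j < m" | "j = m" | "j = Suc m" | "j = Suc (Suc m)" | "j > Suc (Suc m)" by linarith
    then show ?thesis
    proof cases
      case 1
      then show ?thesis
        using face_braid_le[OF sx m_label j] x mn j sigma_eq_one_iff[OF lab N.one_closed]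
        by (simp add: v_def face_degen_cycle)
    next
      case 2
      then show ?thesis
        using face_braid_le[OF sx m_label j] x mn j m
        by (simp add: v_def face_degen_cycle)
    next
      case 3
      then show ?thesis
        using face_braid_1[OF sx m_label] x mn j
        by (simp add: v_def face_degen_cycle nat_add_distrib)
    next
      case 4
      then show ?thesis
        using face_braid_2[OF sx m_label] x mn j
        by (simp add: v_def face_degen_cycle nat_add_distrib)
    next
      case 5
      then have "int m \<in> braid_labels (Suc n)" using j by (auto simp: braid_labels_def)
      then show ?thesis
        using 5 face_braid_greater[OF sx m_label j] x mn j sigma_eq_one_iff[OF _ N.one_closed]
        by (simp add: v_def face_degen_cycle)
    qed
  qed
  \<comment> \<open>The first degenerate factor cancels the face \<open>x\<close> in position \<open>m + 2\<close> at the cost of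
    its inverse in position \<open>m + 1\<close>; the second one cancels that inverse at the cost of \<open>x\<close>
    in position \<open>m\<close>.\<close>
  define w where "w = (v \<otimes>\<^bsub>G (Suc n)\<^esub> s n (Suc m) ?xi) \<otimes>\<^bsub>G (Suc n)\<^esub> s n m x"
  have sxi: "s n (Suc m) ?xi \<in> carrier (G (Suc n))" using mn xc by (simp add: degen_closed)
  show ?thesis
  proof (rule single_face_boundary)
    show "m \<le> Suc n" using mn by simp
    show "?y \<otimes>\<^bsub>G n\<^esub> x \<in> cycles G d n" using y x by (rule cycles_mult)
    show "w \<in> carrier (G (Suc n))" using vc sx sxi by (simp add: w_def)
    fix j assume j: "j \<le> Suc n"
    show "d (Suc n) j w = (if j = m then ?y \<otimes>\<^bsub>G n\<^esub> x else \<one>\<^bsub>G n\<^esub>)"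
      using j vc sx sxi mn xc yc x xi
      by (auto simp: w_def face_mult dv face_degen_cycle)
  qed
qed

lemma homotopy_class_sigma:
  assumes k: "k \<in> braid_labels (Suc n)" and x: "x \<in> cycles G d n"
  shows "homotopy_class n (\<sigma> n k x) = homotopy_class n (inv\<^bsub>G n\<^esub> x)"
proof -
  interpret N: group "G n" by (rule group_G)
  note xc = cycles_in_carrier[OF x]
  have "homotopic G d n (\<sigma> n k x) (inv\<^bsub>G n\<^esub> x)"
    using sigma_mult_boundary[OF k x] xc by (simp add: homotopic_def)
  then show ?thesis using k xc by (simp add: homotopic_iff sigma_closed)
qed

text \<open>If \<open>y\<close> is obtained from \<open>x\<close> by the inverse of \<open>\<sigma>\<^sub>k\<close>, then \<open>y\<close> is again a cycle, and \<open>x = \<sigma>\<^sub>k y\<close>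
  is homotopic to the inverse of \<open>y\<close>. So inverse generators invert
  homotopy classes too.\<close>

lemma homotopy_class_letter:
  fixes e :: bool
  assumes k: "k \<in> braid_labels (Suc n)" and x: "x \<in> cycles G d n"
  defines "y \<equiv> act n (braid_class (Suc n) [(k, e)]) x"
  shows "y \<in> cycles G d n"
    and "homotopy_class n y = inv\<^bsub>G n Mod boundaries G d n\<^esub> homotopy_class n x"
proof -
  interpret q: group_hom "G n" "G n Mod boundaries G d n" "homotopy_class n"
    by (rule homotopy_class_hom)
  note xc = cycles_in_carrier[OF x]
  have "y \<in> cycles G d n \<and>
    homotopy_class n y = inv\<^bsub>G n Mod boundaries G d n\<^esub> homotopy_class n x"
  proof (cases e)
    case True
    then have "y = \<sigma> n k x" by (simp add: y_def \<sigma>_def braid_gen_eq_class)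
    then show ?thesis
      using sigma_cycle_iff[OF k xc] homotopy_class_sigma[OF k x] x xc by simp
  next
    case False
    have c: "braid_class (Suc n) [(k, b)] \<in> carrier (braid_group (Suc n))" for b
      using k by (auto simp: carrier_braid_group)
    have yc: "y \<in> carrier (G n)" using c xc by (simp add: y_def act_closed)
    have sy: "\<sigma> n k y = x"
      using False braid_class_cancel[OF k, of True] act_mult[OF c c xc, of True False] xc
      by (simp add: y_def \<sigma>_def braid_gen_eq_class act_one)
    have y: "y \<in> cycles G d n" using sigma_cycle_iff[OF k yc] x sy by simp
    then have "homotopy_class n x = inv\<^bsub>G n Mod boundaries G d n\<^esub> homotopy_class n y"
      using homotopy_class_sigma[OF k y] sy yc by simp
    then show ?thesis using y yc by simp
  qed
  then show "y \<in> cycles G d n"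
    and "homotopy_class n y = inv\<^bsub>G n Mod boundaries G d n\<^esub> homotopy_class n x" by auto
qed

lemma homotopy_class_word:
  assumes "w \<in> words (braid_labels (Suc n))" and x: "x \<in> cycles G d n"
  shows "act n (braid_class (Suc n) w) x \<in> cycles G d n \<and>
    homotopy_class n (act n (braid_class (Suc n) w) x) =
      homotopy_class n x [^]\<^bsub>G n Mod boundaries G d n\<^esub> (sign (word_perm w) :: int)"
  using assms(1)
proof (induction w)
  interpret q: group_hom "G n" "G n Mod boundaries G d n" "homotopy_class n"
    by (rule homotopy_class_hom)
  note xc = cycles_in_carrier[OF x]
  case Nil
  show ?case using x xc by (simp add: braid_class_Nil act_one)
next
  interpret q: group_hom "G n" "G n Mod boundaries G d n" "homotopy_class n"
    by (rule homotopy_class_hom)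
  note xc = cycles_in_carrier[OF x]
  case (Cons a w)
  obtain k e where a: "a = (k, e)" by (cases a)
  have k: "k \<in> braid_labels (Suc n)" and w: "w \<in> words (braid_labels (Suc n))"
    using Cons.prems by (auto simp: a)
  let ?x = "act n (braid_class (Suc n) w) x"
  have "act n (braid_class (Suc n) (a # w)) x = act n (braid_class (Suc n) [(k, e)]) ?x"
    using braid_class_append[of "[(k, e)]" "Suc n" w] k w xc
    by (simp add: a act_mult carrier_braid_group)
  moreover note homotopy_class_letter[OF k, of ?x e]
  ultimately show ?case
    using Cons.IH w k xc by (simp add: a sign_word_perm_Cons q.H.int_pow_neg del: word_perm_Cons)
qed

theorem braid_acts_by_sign:
  assumes b: "b \<in> carrier (braid_group (Suc n))" and x: "x \<in> cycles G d n"
  shows "homotopic G d n (act n b x) x \<longleftrightarrow>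
    sign (braid_perm b) = 1 \<or> homotopy_class n (inv\<^bsub>G n\<^esub> x) = homotopy_class n x"
proof -
  interpret q: group_hom "G n" "G n Mod boundaries G d n" "homotopy_class n"
    by (rule homotopy_class_hom)
  note xc = cycles_in_carrier[OF x]
  obtain w where w: "w \<in> words (braid_labels (Suc n))" "b = braid_class (Suc n) w"
    using b by (auto simp: carrier_braid_group)
  have "homotopy_class n (act n b x) =
      homotopy_class n x [^]\<^bsub>G n Mod boundaries G d n\<^esub> (sign (braid_perm b) :: int)"
    using homotopy_class_word[OF w(1) x] w by (simp add: sign_braid_perm_class)
  then have "homotopic G d n (act n b x) x \<longleftrightarrow>
      homotopy_class n x [^]\<^bsub>G n Mod boundaries G d n\<^esub> (sign (braid_perm b) :: int)
        = homotopy_class n x"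
    using b xc by (simp add: homotopic_iff act_closed)
  then show ?thesis
    using xc by (cases "evenperm (braid_perm b)") (auto simp: sign_def q.H.int_pow_neg)
qed

end

theorem theorem2p9:
  fixes G :: "nat \<Rightarrow> ('a, 'b) monoid_scheme"
    and d s :: "nat \<Rightarrow> nat \<Rightarrow> 'a \<Rightarrow> 'a"
    and act :: "nat \<Rightarrow> int word set \<Rightarrow> 'a \<Rightarrow> 'a"
    and n :: nat
  assumes "braided_simplicial_group G d s act"
  shows "(cycle_stabilizer G d act n = even_braids (Suc n) \<or>
          cycle_stabilizer G d act n = carrier (braid_group (Suc n))) \<and>
         (n \<ge> 1 \<longrightarrow>
           (cycle_stabilizer G d act n = carrier (braid_group (Suc n)) \<longleftrightarrow>
            (\<forall>p \<in> carrier (homotopy_group G d n).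
               p [^]\<^bsub>homotopy_group G d n\<^esub> (2::nat) = \<one>\<^bsub>homotopy_group G d n\<^esub>)))"
proof -
  interpret braided_simplicial_group G d s act "\<lambda>n k. act n (braid_gen (Suc n) k)"
    by (fact assms)
  let ?two_torsion = "\<forall>x\<in>cycles G d n. homotopy_class n (inv\<^bsub>G n\<^esub> x) = homotopy_class n x"
  have stab: "cycle_stabilizer G d act n =
      {b \<in> carrier (braid_group (Suc n)). sign (braid_perm b) = 1 \<or> ?two_torsion}"
    by (auto simp: cycle_stabilizer_def braid_acts_by_sign)
  have "(\<forall>p \<in> carrier (homotopy_group G d n).
      p [^]\<^bsub>homotopy_group G d n\<^esub> (2::nat) = \<one>\<^bsub>homotopy_group G d n\<^esub>) \<longleftrightarrow> ?two_torsion"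
    by (auto simp: carrier_homotopy_group homotopy_group_square cycles_in_carrier)
  moreover have "\<exists>b\<in>carrier (braid_group (Suc n)). sign (braid_perm b) \<noteq> 1" if "n \<ge> 1"
  proof
    have k: "- 1 \<in> braid_labels (Suc n)" using that by (simp add: braid_labels_def)
    then show "braid_gen (Suc n) (- 1) \<in> carrier (braid_group (Suc n))" by (rule gen_in_carrier)
    show "sign (braid_perm (braid_gen (Suc n) (- 1))) \<noteq> 1"
      using k sign_word_perm_Cons[OF k Nil_in_words, of True]
      by (simp add: braid_gen_eq_class sign_braid_perm_class del: word_perm_Cons)
  qed
  ultimately show ?thesis
    by (cases ?two_torsion) (auto simp: stab mem_even_braids_iff)
qed

end
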